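(* Suppose $(Z,U)\sim P_{Z,U}$, and fix $\alpha\in[0,1]$. Let $P_{S,T}$ be the induced joint distribution of $(S,T)=(\mathsf{s}(Z,U),\mathsf{t}_\alpha(U))$. Then the p-value $$p=p(Z,U),\qquad p(z,u)=\mathbb{P}_{Z'\sim Q_{Z\mid U=u}}\{\mathsf{s}(Z',u)\ge \mathsf{s}(z,u)\},$$ satisfies $$\mathbb{P}\{p\le\alpha\}\le \alpha+\inf_{Q_U}\, d_{TV}(P_{S,T},Q_{S,T}),$$ where the infimum is taken over all distributions $Q_U$ on $\mathcal{U}$, and where $Q_{S,T}$ denotes the joint distribution of $(S,T)=(\mathsf{s}(Z,U),\mathsf{t}_\alpha(U))$ induced by drawing $(Z,U)\sim Q_{Z,U}=Q_{Z\mid U}\times Q_U$.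
   Context: Let $\mathcal{Z}=\mathcal{X}\times\mathcal{Y}$ and $\mathcal{U}$ be measurable spaces and $n\ge1$ an integer; all functions and kernels are assumed measurable. For $z=(z_1,\dots,z_{n+1})\in\mathcal{Z}^{n+1}$, write $\mathrm{bag}(z)$ for the unordered multiset of the entries of $z$. Unified framework. (i) The data $Z$ takes values in $\mathcal{Z}^{n+1}$ and the partial information $U$ is a random variable in $\mathcal{U}$ with $\mathrm{bag}(Z)=h(U)$ almost surely under $P_{Z,U}$, for some function $h$; $U$ need not be a deterministic function of $Z$. (ii) $\mathsf{s}:\mathcal{Z}^{n+1}\times\mathcal{U}\to\mathbb{R}$ is a score function. (iii) $Q_{Z\mid U}$ is a user-chosen conditional distribution: for each $u\in\mathcal{U}$, $Q_{Z\mid U=u}$ is a probability distribution supported in the finite set $\{z\in\mathcal{Z}^{n+1}:\mathrm{bag}(z)=h(u)\}$. It is not required to equal the true conditional distribution of $Z\mid U$. $Q_{Z\mid U}\times Q_U$ denotes the joint distribution of $(Z,U)$ obtained by drawing $U\sim Q_U$ and then $Z\mid U\sim Q_{Z\mid U}$. The quantile is $\mathrm{Quantile}_\tau(P)=\inf\{x\in\mathbb{R}:\mathbb{P}_{V\sim P}\{V\le x\}\ge\tau\}$ (so it equals $-\infty$ for $\tau=0$). The threshold is $\mathsf{t}_\alpha(u)=\mathrm{Quantile}_{1-\alpha}(Q_{S\mid U=u})$, where $Q_{S\mid U=u}$ is the distribution of $\mathsf{s}(Z,u)$ for $Z\sim Q_{Z\mid U=u}$. $d_{TV}(P,Q)=\sup_A\{P(A)-Q(A)\}$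 is the total variation distance, the supremum being over measurable sets. *)

theory Defs
  imports "HOL-Probability.Probability" "HOL-Library.Multiset"
begin

definition data_space :: "nat \<Rightarrow> 'z measure \<Rightarrow> (nat \<Rightarrow> 'z) measure" where
  "data_space n MZ = PiM {1..n+1} (\<lambda>_. MZ)"

definition bag :: "nat \<Rightarrow> (nat \<Rightarrow> 'z) \<Rightarrow> 'z multiset" where
  "bag n z = image_mset z (mset_set {1..n+1})"

(* Singletons need not be measurable, so A is not assumed to be. For a probability measure M
   and finite A \<subseteq> space M, this says that M is a convex combination of point masses at elements
   of A; for measurable A it is equivalent to (AE x in M. x \<in> A). *)
definition supported_in :: "'a measure \<Rightarrow> 'a set \<Rightarrow> bool" where
  "supported_in M A \<longleftrightarrow> (\<forall>B \<in> sets M. B \<inter> A = {} \<longrightarrow> emeasure M B = 0)"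

(* Extended real valued: the infimum is -\<infinity> for \<tau> = 0, and \<infinity> if the set is empty. *)
definition quantile :: "real \<Rightarrow> real measure \<Rightarrow> ereal" where
  "quantile \<tau> P = (INF x \<in> {x. cdf P x \<ge> \<tau>}. ereal x)"

definition threshold ::
  "('z \<times> 'u \<Rightarrow> real) \<Rightarrow> ('u \<Rightarrow> 'z measure) \<Rightarrow> real \<Rightarrow> 'u \<Rightarrow> ereal" where
  "threshold s Q \<alpha> u = quantile (1 - \<alpha>) (distr (Q u) borel (\<lambda>z. s (z, u)))"

definition pvalue :: "('z \<times> 'u \<Rightarrow> real) \<Rightarrow> ('u \<Rightarrow> 'z measure) \<Rightarrow> 'z \<Rightarrow> 'u \<Rightarrow> real" where
  "pvalue s Q z u = \<P>(z' in Q u. s (z', u) \<ge> s (z, u))"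

definition joint_law ::
  "'z measure \<Rightarrow> 'u measure \<Rightarrow> ('u \<Rightarrow> 'z measure) \<Rightarrow> 'u measure \<Rightarrow> ('z \<times> 'u) measure" where
  "joint_law MZ MU Q QU =
     QU \<bind> (\<lambda>u. Q u \<bind> (\<lambda>z. return (MZ \<Otimes>\<^sub>M MU) (z, u)))"

definition ST_law ::
  "('z \<times> 'u \<Rightarrow> real) \<Rightarrow> ('u \<Rightarrow> 'z measure) \<Rightarrow> real \<Rightarrow> ('z \<times> 'u) measure
     \<Rightarrow> (real \<times> ereal) measure" where
  "ST_law s Q \<alpha> R =
     distr R (borel \<Otimes>\<^sub>M borel) (\<lambda>(z, u). (s (z, u), threshold s Q \<alpha> u))"

definition tv_dist :: "'a measure \<Rightarrow> 'a measure \<Rightarrow> real" where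
  "tv_dist P Q = (SUP A \<in> sets P. measure P A - measure Q A)"

end

theory Submission
  imports Defs
begin

text \<open>
  The event that the p-value is at most \<open>\<alpha>\<close> is contained in the event \<open>S > T\<close>, which depends only
  on the pair \<open>(S, T)\<close>. Indeed \<open>p \<le> \<alpha>\<close> says that \<open>Q u\<close> gives mass at least \<open>1 - \<alpha>\<close> to scores strictly
  below the observed one; since there are only finitely many possible scores, this mass already sits
  at or below some number strictly smaller than the observed score, so that the
  \<open>(1 - \<alpha>)\<close>-quantile is strictly smaller too (\<open>quantile_less_if_finite_support\<close>).

  If \<open>Z\<close> were drawn from \<open>Q u\<close>, the event \<open>S > T\<close> would have probability at most \<open>\<alpha>\<close>, because a
  distribution function has reached the level \<open>\<tau>\<close> at its \<open>\<tau>\<close>-quantile (\<open>prob_greater_quantile_le\<close>).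
  Averaging over \<open>U\<close> gives the same bound for every choice of the law of \<open>U\<close>
  (\<open>joint_law_exceed_le\<close>). Replacing this law of \<open>(S, T)\<close> by the true one costs at most their total
  variation distance, and the law of \<open>U\<close> was arbitrary.
\<close>

section \<open>Quantiles\<close>

text \<open>The infimum defining a finite quantile is attained because distribution functions are
  right-continuous; the equivalence also covers the levels at which the quantile is infinite.\<close>

lemma quantile_le_iff:
  assumes "real_distribution P"
  shows "quantile \<tau> P \<le> ereal x \<longleftrightarrow> \<tau> \<le> cdf P x"
proof
  interpret real_distribution P by fact
  assume le: "quantile \<tau> P \<le> ereal x"
  have above: "\<tau> \<le> cdf P y" if "x < y" for y
  proof -
    have "quantile \<tau> P < ereal y"
      using le that by (meson ereal_less(2) le_less_trans less_ereal.simps(1))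
    then obtain w where "\<tau> \<le> cdf P w" "w < y"
      by (auto simp: quantile_def INF_less_iff)
    then show ?thesis
      using cdf_nondecreasing[of w y] by linarith
  qed
  have "(cdf P \<longlongrightarrow> cdf P x) (at_right x)"
    using cdf_is_right_cont[of x] by (simp add: continuous_within)
  moreover have "\<forall>\<^sub>F y in at_right x. \<tau> \<le> cdf P y"
    using above by (auto simp: eventually_at_filter)
  ultimately show "\<tau> \<le> cdf P x"
    by (intro tendsto_lowerbound[where F = "at_right x"]) auto
next
  assume "\<tau> \<le> cdf P x"
  then show "quantile \<tau> P \<le> ereal x"
    unfolding quantile_def by (intro INF_lower) simp
qed

lemma prob_greater_quantile_le:
  assumes "real_distribution P" and "\<tau> \<le> 1"
  shows "measure P {x. quantile \<tau> P < ereal x} \<le> 1 - \<tau>"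
proof -
  interpret real_distribution P by fact
  show ?thesis
  proof (cases "quantile \<tau> P")
    case (real q)
    then have "\<tau> \<le> cdf P q"
      using quantile_le_iff[OF assms(1), of \<tau> q] by simp
    moreover have "{x. quantile \<tau> P < ereal x} = space P - {..q}"
      using real by auto
    ultimately show ?thesis
      using prob_compl[of "{..q}"] by (simp add: cdf_def)
  next
    case PInf
    then show ?thesis using assms(2) by simp
  next
    case MInf
    \<comment> \<open>The distribution function is at least \<open>\<tau>\<close> everywhere, but it tends to \<open>0\<close> at \<open>-\<infinity>\<close>.\<close>
    then have "\<tau> \<le> cdf P x" for x
      using quantile_le_iff[OF assms(1), of \<tau> x] by simp
    then have "\<tau> \<le> 0"
      using cdf_lim_at_bot by (intro tendsto_lowerbound[where F = at_bot]) auto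
    then show ?thesis
      using prob_le_1[of "{x. quantile \<tau> P < ereal x}"] by linarith
  qed
qed

text \<open>Finiteness of the support makes the inequality strict: the mass that \<open>f\<close> puts below \<open>c\<close> lies
  at or below the largest value that \<open>f\<close> attains below \<open>c\<close> on the support. For a law without a gap
  below \<open>c\<close>, the quantile could be equal to \<open>c\<close>.\<close>

lemma quantile_less_if_finite_support:
  assumes "prob_space M" and [measurable]: "f \<in> borel_measurable M"
    and "finite A" and "supported_in M A"
    and tail: "\<P>(z in M. c \<le> f z) \<le> 1 - \<tau>"
  shows "quantile \<tau> (distr M borel f) < ereal c"
proof -
  interpret prob_space M by fact
  \<comment> \<open>The term \<open>c - 1\<close> only serves the case that \<open>f\<close> has no value below \<open>c\<close> on \<open>A\<close>.\<close>
  define V where "V = insert (c - 1) {v \<in> f ` A. v < c}"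
  define x where "x = Max V"
  have fin: "finite V" and "V \<noteq> {}"
    using \<open>finite A\<close> by (auto simp: V_def)
  then have "x \<in> V"
    unfolding x_def by (rule Max_in)
  then have "x < c"
    by (auto simp: V_def)
  have "{z \<in> space M. x < f z \<and> f z < c} \<inter> A = {}"
  proof -
    have "f a \<le> x" if "a \<in> A" "f a < c" for a
      unfolding x_def using that by (intro Max_ge[OF fin]) (auto simp: V_def)
    then show ?thesis by fastforce
  qed
  moreover have "{z \<in> space M. x < f z \<and> f z < c} \<in> sets M"
    by measurable
  ultimately have "emeasure M {z \<in> space M. x < f z \<and> f z < c} = 0"
    using \<open>supported_in M A\<close> by (auto simp: supported_in_def)
  then have "AE z in M. \<not> (x < f z \<and> f z < c)"
    by (subst AE_iff_measurable[OF _ refl]) auto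
  then have "\<P>(z in M. \<not> c \<le> f z) = \<P>(z in M. f z \<le> x)"
    using \<open>x < c\<close> by (intro prob_eq_AE) auto
  moreover have "\<P>(z in M. f z \<le> x) = cdf (distr M borel f) x"
    by (auto simp: cdf_def measure_distr intro!: arg_cong[where f = "measure M"])
  moreover have "\<P>(z in M. \<not> c \<le> f z) = 1 - \<P>(z in M. c \<le> f z)"
    by (intro prob_neg) measurable
  ultimately have "\<tau> \<le> cdf (distr M borel f) x"
    using tail by linarith
  then have "quantile \<tau> (distr M borel f) \<le> ereal x"
    by (simp add: quantile_le_iff real_distribution_distr)
  then show ?thesis
    using \<open>x < c\<close> by (meson le_less_trans less_ereal.simps(1))
qed

section \<open>The score and its threshold under a kernel\<close>

lemma finite_bag_fibre:
  "finite {z \<in> space (data_space n M). bag n z = b}"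
proof (rule finite_subset)
  show "{z \<in> space (data_space n M). bag n z = b} \<subseteq> PiE {1..n+1} (\<lambda>_. set_mset b)"
    by (auto simp: data_space_def bag_def space_PiM PiE_iff extensional_def)
  show "finite (PiE {1..n+1} (\<lambda>_. set_mset b))"
    by (intro finite_PiE) auto
qed

text \<open>The framework for an arbitrary data space: bags enter the argument through the finiteness of
  their fibres alone.\<close>

locale score_kernel =
  fixes MZ :: "'z measure" and MU :: "'u measure"
    and s :: "'z \<times> 'u \<Rightarrow> real" and Q :: "'u \<Rightarrow> 'z measure" and \<alpha> :: real
  assumes s_measurable [measurable]: "s \<in> borel_measurable (MZ \<Otimes>\<^sub>M MU)"
    and Q_measurable [measurable]: "Q \<in> MU \<rightarrow>\<^sub>M prob_algebra MZ"
    and \<alpha>_nonneg: "0 \<le> \<alpha>"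
begin

lemma prob_space_Q: "u \<in> space MU \<Longrightarrow> prob_space (Q u)"
  and sets_Q: "u \<in> space MU \<Longrightarrow> sets (Q u) = sets MZ"
  using measurable_space[OF Q_measurable] by (auto simp: space_prob_algebra)

lemma score_measurable_Q:
  assumes "u \<in> space MU"
  shows "(\<lambda>z. s (z, u)) \<in> borel_measurable (Q u)"
proof -
  have "(\<lambda>z. s (z, u)) \<in> borel_measurable MZ"
    using assms by measurable
  then show ?thesis
    by (simp add: measurable_cong_sets[OF sets_Q[OF assms] refl])
qed

lemma real_distribution_score:
  "u \<in> space MU \<Longrightarrow> real_distribution (distr (Q u) borel (\<lambda>z. s (z, u)))"
  by (intro prob_space.real_distribution_distr prob_space_Q score_measurable_Q)

lemma threshold_le_iff:
  assumes "u \<in> space MU"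
  shows "threshold s Q \<alpha> u \<le> ereal x \<longleftrightarrow> 1 - \<alpha> \<le> measure (Q u) {z \<in> space MZ. s (z, u) \<le> x}"
proof -
  have "cdf (distr (Q u) borel (\<lambda>z. s (z, u))) x = measure (Q u) {z \<in> space MZ. s (z, u) \<le> x}"
    using sets_eq_imp_space_eq[OF sets_Q[OF assms]]
    by (auto simp: cdf_def measure_distr[OF score_measurable_Q[OF assms]]
             intro!: arg_cong[where f = "measure (Q u)"])
  then show ?thesis
    unfolding threshold_def by (simp add: quantile_le_iff[OF real_distribution_score[OF assms]])
qed

text \<open>By \<open>threshold_le_iff\<close>, the sublevel sets of the threshold are defined by the probabilities that
  the kernel gives to half-lines of scores, and these are measurable in \<open>u\<close>.\<close>

lemma threshold_measurable [measurable]: "threshold s Q \<alpha> \<in> borel_measurable MU"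
proof -
  have le_real: "{u \<in> space MU. threshold s Q \<alpha> u \<le> ereal x} \<in> sets MU" for x
  proof -
    have "{u \<in> space MU. threshold s Q \<alpha> u \<le> ereal x}
        = {u \<in> space MU. 1 - \<alpha> \<le> measure (Q u) {z \<in> space MZ. s (z, u) \<le> x}}"
      using threshold_le_iff by auto
    also have "\<dots> \<in> sets MU"
    proof -
      have "(\<lambda>u. measure (Q u) {z \<in> space MZ. s (z, u) \<le> x}) \<in> borel_measurable MU"
      proof (rule measure_measurable_subprob_algebra2)
        have "(SIGMA u:space MU. {z \<in> space MZ. s (z, u) \<le> x})
            = {w \<in> space (MU \<Otimes>\<^sub>M MZ). s (snd w, fst w) \<le> x}"
          by (auto simp: space_pair_measure)
        also have "\<dots> \<in> sets (MU \<Otimes>\<^sub>M MZ)"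
          by measurable
        finally show "(SIGMA u:space MU. {z \<in> space MZ. s (z, u) \<le> x}) \<in> sets (MU \<Otimes>\<^sub>M MZ)" .
        show "Q \<in> MU \<rightarrow>\<^sub>M subprob_algebra MZ"
          by (rule measurable_prob_algebraD) (rule Q_measurable)
      qed
      then show ?thesis by measurable
    qed
    finally show ?thesis .
  qed
  have "{u \<in> space MU. threshold s Q \<alpha> u \<le> a} \<in> sets MU" for a
  proof (cases a)
    case (real x)
    then show ?thesis using le_real by simp
  next
    case PInf
    then show ?thesis by simp
  next
    case MInf
    have "threshold s Q \<alpha> u \<le> -\<infinity> \<longleftrightarrow> (\<forall>k::nat. threshold s Q \<alpha> u \<le> ereal (- real k))" for u
    proof
      assume below: "\<forall>k::nat. threshold s Q \<alpha> u \<le> ereal (- real k)"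
      have "threshold s Q \<alpha> u \<le> ereal B" for B
      proof -
        obtain k :: nat where "- B \<le> real k"
          using real_arch_simple by blast
        then have "ereal (- real k) \<le> ereal B" by simp
        with below show ?thesis
          by (meson order_trans)
      qed
      then show "threshold s Q \<alpha> u \<le> -\<infinity>"
        by (simp add: ereal_bot)
    qed auto
    then have "{u \<in> space MU. threshold s Q \<alpha> u \<le> a}
        = {u \<in> space MU. \<forall>k::nat. threshold s Q \<alpha> u \<le> ereal (- real k)}"
      using MInf by simp
    also have "\<dots> \<in> sets MU"
      using le_real by (intro sets.sets_Collect_countable_All) auto
    finally show ?thesis .
  qed
  then show ?thesis
    by (simp add: borel_measurable_iff_Iic_ereal vimage_def Int_def conj_commute)
qed

lemma score_threshold_measurable [measurable]:
  "(\<lambda>(z, u). (s (z, u), threshold s Q \<alpha> u)) \<in> MZ \<Otimes>\<^sub>M MU \<rightarrow>\<^sub>M borel \<Otimes>\<^sub>M borel"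
  by measurable

lemma exceed_sets [measurable]:
  "{w \<in> space (MZ \<Otimes>\<^sub>M MU). threshold s Q \<alpha> (snd w) < ereal (s w)} \<in> sets (MZ \<Otimes>\<^sub>M MU)"
  by measurable

lemma exceed_pairs_sets:
  "{p. snd p < ereal (fst p)} \<in> sets (borel \<Otimes>\<^sub>M borel :: (real \<times> ereal) measure)"
proof -
  have "{p \<in> space (borel \<Otimes>\<^sub>M borel :: (real \<times> ereal) measure). snd p < ereal (fst p)}
      \<in> sets (borel \<Otimes>\<^sub>M borel)"
    by measurable
  then show ?thesis by (simp add: space_pair_measure)
qed

lemma measure_ST_law_exceed:
  assumes "R \<in> space (prob_algebra (MZ \<Otimes>\<^sub>M MU))"
  shows "measure (ST_law s Q \<alpha> R) {p. snd p < ereal (fst p)}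
    = measure R {w \<in> space (MZ \<Otimes>\<^sub>M MU). threshold s Q \<alpha> (snd w) < ereal (s w)}"
proof -
  have sets_R: "sets R = sets (MZ \<Otimes>\<^sub>M MU)"
    using assms by (simp add: space_prob_algebra)
  have meas: "(\<lambda>(z, u). (s (z, u), threshold s Q \<alpha> u)) \<in> R \<rightarrow>\<^sub>M borel \<Otimes>\<^sub>M borel"
    unfolding measurable_cong_sets[OF sets_R refl] by (rule score_threshold_measurable)
  show ?thesis
    unfolding ST_law_def measure_distr[OF meas exceed_pairs_sets]
    using sets_eq_imp_space_eq[OF sets_R]
    by (auto intro!: arg_cong[where f = "measure R"] split: prod.splits)
qed

lemma prob_space_ST_law:
  assumes "R \<in> space (prob_algebra (MZ \<Otimes>\<^sub>M MU))"
  shows "prob_space (ST_law s Q \<alpha> R)"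
proof -
  have sets_R: "sets R = sets (MZ \<Otimes>\<^sub>M MU)" and "prob_space R"
    using assms by (auto simp: space_prob_algebra)
  then show ?thesis
    unfolding ST_law_def
    by (intro prob_space.prob_space_distr)
       (simp_all only: measurable_cong_sets[OF sets_R refl] score_threshold_measurable)
qed

lemma pair_kernel_measurable:
  "(\<lambda>u. Q u \<bind> (\<lambda>z. return (MZ \<Otimes>\<^sub>M MU) (z, u))) \<in> MU \<rightarrow>\<^sub>M prob_algebra (MZ \<Otimes>\<^sub>M MU)"
  by measurable

lemma joint_law_in_prob_algebra:
  assumes "QU \<in> space (prob_algebra MU)"
  shows "joint_law MZ MU Q QU \<in> space (prob_algebra (MZ \<Otimes>\<^sub>M MU))"
  unfolding joint_law_def space_prob_algebra
  using prob_space_bind'[OF assms pair_kernel_measurable] sets_bind'[OF assms pair_kernel_measurable]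
  by simp

lemma kernel_exceed_le:
  assumes "u \<in> space MU"
  shows "\<P>(z in Q u. threshold s Q \<alpha> u < ereal (s (z, u))) \<le> \<alpha>"
proof -
  let ?D = "distr (Q u) borel (\<lambda>z. s (z, u))"
  have "\<P>(z in Q u. threshold s Q \<alpha> u < ereal (s (z, u)))
      = measure ?D {x. quantile (1 - \<alpha>) ?D < ereal x}"
    by (subst measure_distr[OF score_measurable_Q[OF assms]])
       (auto simp: threshold_def intro!: arg_cong[where f = "measure (Q u)"])
  also have "\<dots> \<le> 1 - (1 - \<alpha>)"
    using \<alpha>_nonneg by (intro prob_greater_quantile_le real_distribution_score assms) simp
  finally show ?thesis by simp
qed

lemma joint_law_exceed_le:
  assumes QU: "QU \<in> space (prob_algebra MU)"
  shows "measure (joint_law MZ MU Q QU)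
      {w \<in> space (MZ \<Otimes>\<^sub>M MU). threshold s Q \<alpha> (snd w) < ereal (s w)} \<le> \<alpha>"
    (is "measure _ ?B \<le> \<alpha>")
proof -
  interpret QU: prob_space QU using QU by (simp add: space_prob_algebra)
  have sets_QU: "sets QU = sets MU" using QU by (simp add: space_prob_algebra)
  then have space_QU: "space QU = space MU" by (rule sets_eq_imp_space_eq)
  have fibre: "emeasure (Q u \<bind> (\<lambda>z. return (MZ \<Otimes>\<^sub>M MU) (z, u))) ?B \<le> ennreal \<alpha>"
    if u: "u \<in> space MU" for u
  proof -
    interpret Qu: prob_space "Q u" by (rule prob_space_Q[OF u])
    have space_Qu: "space (Q u) = space MZ" by (rule sets_eq_imp_space_eq[OF sets_Q[OF u]])
    have pair: "(\<lambda>z. (z, u)) \<in> Q u \<rightarrow>\<^sub>M MZ \<Otimes>\<^sub>M MU"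
      unfolding measurable_cong_sets[OF sets_Q[OF u] refl] using u by measurable
    have "Q u \<bind> (\<lambda>z. return (MZ \<Otimes>\<^sub>M MU) (z, u)) = distr (Q u) (MZ \<Otimes>\<^sub>M MU) (\<lambda>z. (z, u))"
      using Qu.not_empty pair by (rule bind_return_distr')
    then have "emeasure (Q u \<bind> (\<lambda>z. return (MZ \<Otimes>\<^sub>M MU) (z, u))) ?B
        = emeasure (Q u) ((\<lambda>z. (z, u)) -` ?B \<inter> space (Q u))"
      by (simp add: emeasure_distr[OF pair exceed_sets])
    also have "(\<lambda>z. (z, u)) -` ?B \<inter> space (Q u)
        = {z \<in> space (Q u). threshold s Q \<alpha> u < ereal (s (z, u))}"
      using u by (auto simp: space_pair_measure space_Qu)
    finally show ?thesis
      using kernel_exceed_le[OF u] by (simp add: Qu.emeasure_eq_measure ennreal_leI)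
  qed
  have "emeasure (joint_law MZ MU Q QU) ?B
      = (\<integral>\<^sup>+u. emeasure (Q u \<bind> (\<lambda>z. return (MZ \<Otimes>\<^sub>M MU) (z, u))) ?B \<partial>QU)"
    unfolding joint_law_def by (rule emeasure_bind_prob_algebra[OF QU pair_kernel_measurable exceed_sets])
  also have "\<dots> \<le> (\<integral>\<^sup>+u. ennreal \<alpha> \<partial>QU)"
    using fibre by (intro nn_integral_mono) (simp add: space_QU)
  also have "\<dots> = ennreal \<alpha>"
    by (simp add: QU.emeasure_space_1)
  finally show ?thesis
    unfolding measure_def using \<alpha>_nonneg by (simp add: enn2real_leI)
qed

lemma pvalue_le_imp_exceed:
  assumes u: "u \<in> space MU" and "finite A" and "supported_in (Q u) A"
    and "pvalue s Q z u \<le> \<alpha>"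
  shows "threshold s Q \<alpha> u < ereal (s (z, u))"
  unfolding threshold_def
  using assms prob_space_Q[OF u] score_measurable_Q[OF u]
  by (intro quantile_less_if_finite_support[where A = A]) (auto simp: pvalue_def)

end

section \<open>Total variation and the p-value bound\<close>

lemma measure_diff_le_tv_dist:
  assumes "prob_space M" and "A \<in> sets M"
  shows "measure M A - measure N A \<le> tv_dist M N"
  unfolding tv_dist_def
proof (rule cSUP_upper[OF assms(2)])
  interpret prob_space M by fact
  have "measure M B - measure N B \<le> 1" for B
    using prob_le_1[of B] measure_nonneg[of N B] by linarith
  then show "bdd_above ((\<lambda>A. measure M A - measure N A) ` sets M)"
    by (intro bdd_aboveI2[where M = 1])
qed

theorem theorem2:
  fixes n :: nat
    and MX :: "'x measure" and MY :: "'y measure" and MU :: "'u measure"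
    and MB :: "('x \<times> 'y) multiset measure"
    and h :: "'u \<Rightarrow> ('x \<times> 'y) multiset"
    and s :: "(nat \<Rightarrow> 'x \<times> 'y) \<times> 'u \<Rightarrow> real"
    and Q :: "'u \<Rightarrow> (nat \<Rightarrow> 'x \<times> 'y) measure"
    and P :: "((nat \<Rightarrow> 'x \<times> 'y) \<times> 'u) measure"
    and \<alpha> :: real
  defines "Zn \<equiv> data_space n (MX \<Otimes>\<^sub>M MY)"
  assumes "n \<ge> 1"
    and "P \<in> space (prob_algebra (Zn \<Otimes>\<^sub>M MU))"
    and "h \<in> MU \<rightarrow>\<^sub>M MB"
    and "AE (z, u) in P. bag n z = h u"
    and "s \<in> borel_measurable (Zn \<Otimes>\<^sub>M MU)"
    and "Q \<in> MU \<rightarrow>\<^sub>M prob_algebra Zn"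
    and "\<And>u. u \<in> space MU \<Longrightarrow> supported_in (Q u) {z \<in> space Zn. bag n z = h u}"
    and "0 \<le> \<alpha>" and "\<alpha> \<le> 1"
  shows "\<P>((z, u) in P. pvalue s Q z u \<le> \<alpha>)
    \<le> \<alpha> + (INF QU \<in> space (prob_algebra MU).
          tv_dist (ST_law s Q \<alpha> P) (ST_law s Q \<alpha> (joint_law Zn MU Q QU)))"
proof -
  note asms = assms(2-)
  interpret score_kernel Zn MU s Q \<alpha>
    using asms by unfold_locales auto
  interpret P: prob_space P using asms(2) by (simp add: space_prob_algebra)
  have sets_P: "sets P = sets (Zn \<Otimes>\<^sub>M MU)" using asms(2) by (simp add: space_prob_algebra)
  then have space_P: "space P = space (Zn \<Otimes>\<^sub>M MU)" by (rule sets_eq_imp_space_eq)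
  have fin: "finite {z \<in> space Zn. bag n z = h u}" for u
    unfolding Zn_def by (rule finite_bag_fibre)
  let ?E = "{p. snd p < ereal (fst p)} :: (real \<times> ereal) set"
  have bound: "\<P>((z, u) in P. pvalue s Q z u \<le> \<alpha>) - \<alpha>
      \<le> tv_dist (ST_law s Q \<alpha> P) (ST_law s Q \<alpha> (joint_law Zn MU Q QU))"
    if QU: "QU \<in> space (prob_algebra MU)" for QU
  proof -
    have "\<P>((z, u) in P. pvalue s Q z u \<le> \<alpha>)
        \<le> measure P {w \<in> space (Zn \<Otimes>\<^sub>M MU). threshold s Q \<alpha> (snd w) < ereal (s w)}"
    proof (rule P.finite_measure_mono)
      show "{(z, u) \<in> space P. pvalue s Q z u \<le> \<alpha>}
          \<subseteq> {w \<in> space (Zn \<Otimes>\<^sub>M MU). threshold s Q \<alpha> (snd w) < ereal (s w)}"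
        using pvalue_le_imp_exceed[OF _ fin asms(7)] by (auto simp: space_P space_pair_measure)
      show "{w \<in> space (Zn \<Otimes>\<^sub>M MU). threshold s Q \<alpha> (snd w) < ereal (s w)} \<in> sets P"
        unfolding sets_P by (rule exceed_sets)
    qed
    also have "\<dots> = measure (ST_law s Q \<alpha> P) ?E"
      by (rule measure_ST_law_exceed[OF asms(2), symmetric])
    finally have "\<P>((z, u) in P. pvalue s Q z u \<le> \<alpha>) \<le> measure (ST_law s Q \<alpha> P) ?E" .
    moreover have "measure (ST_law s Q \<alpha> (joint_law Zn MU Q QU)) ?E \<le> \<alpha>"
      unfolding measure_ST_law_exceed[OF joint_law_in_prob_algebra[OF QU]]
      by (rule joint_law_exceed_le[OF QU])
    moreover have "measure (ST_law s Q \<alpha> P) ?E - measure (ST_law s Q \<alpha> (joint_law Zn MU Q QU)) ?E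
        \<le> tv_dist (ST_law s Q \<alpha> P) (ST_law s Q \<alpha> (joint_law Zn MU Q QU))"
      using exceed_pairs_sets
      by (intro measure_diff_le_tv_dist prob_space_ST_law asms(2)) (simp add: ST_law_def)
    ultimately show ?thesis by linarith
  qed
  \<comment> \<open>An infimum of reals is only meaningful over a nonempty set; the true law of \<open>U\<close> is a member.\<close>
  have "distr P MU snd \<in> space (prob_algebra MU)"
  proof -
    have "snd \<in> P \<rightarrow>\<^sub>M MU"
      unfolding measurable_cong_sets[OF sets_P refl] by (rule measurable_snd)
    then show ?thesis
      by (simp add: space_prob_algebra P.prob_space_distr)
  qed
  then have "\<P>((z, u) in P. pvalue s Q z u \<le> \<alpha>) - \<alpha>
      \<le> (INF QU \<in> space (prob_algebra MU).
          tv_dist (ST_law s Q \<alpha> P) (ST_law s Q \<alpha> (joint_law Zn MU Q QU)))"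
    using bound by (intro cINF_greatest) auto
  then show ?thesis by linarith
qed

end
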